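(* Let $d>0$ and $0<\alpha\le\beta<\infty$. There exist two constants $C>c>0$, depending only on $d,\alpha,\beta$, such that the following holds. Let $F\subset\mathbb{R}^k$ be a compact connected set and let $\mu$ be a Borel probability measure on $F$ which is semi-uniform of dimension $d$ with parameters $\delta_0,\alpha,\beta$ for some $\delta_0>0$. Then for every $\epsilon>0$ there is $m_0$ (depending on $\epsilon$, $F$ and $\mu$) such that for every integer $m\ge m_0$, if $X_1,\dots,X_m$ are independent samples from $\mu$, then: (1) for every $r>C\left(\frac{\log m}{m}\right)^{1/d}$, the set $\bigcup_{i=1}^m B(X_i,r)$ is connected with probability at least $1-\epsilon$; (2) for every $0<r<c\left(\frac{\log m}{m}\right)^{1/d}$, the set $\bigcup_{i=1}^m B(X_i,r)$ is connected with probability at most $\epsilon$.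
   Context: $B(x,r)=\{y\in\mathbb{R}^k:|x-y|<r\}$ is the ball of radius $r$ centered at $x$ in the Euclidean metric; for a measure $\mu$ on $F\subset\mathbb{R}^k$ write $\mu(B(x,r))$ for $\mu(B(x,r)\cap F)$. A Borel probability measure $\mu$ on $F$ is semi-uniform of dimension $d$ with parameters $\delta_0>0$ and $0<\alpha\le\beta<\infty$ if for every $x\in F$ and every $0<\delta<\delta_0$ one has $\alpha\delta^d\le\mu(B(x,\delta))\le\beta\delta^d$. $\log$ is the natural logarithm. *)

theory Defs
  imports "HOL-Probability.Probability"
begin

text \<open>
  The ambient dimension \<open>k\<close> has to be quantified inside the statement (the constants \<open>C\<close> and \<open>c\<close>
  do not depend on it), so it cannot be a type index. We use the library's \<^const>\<open>Euclidean_space\<close>: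
  a point of \<open>\<real>\<^sup>k\<close> is a function \<^typ>\<open>nat \<Rightarrow> real\<close> vanishing at all indices \<open>\<ge> k\<close>, with the
  topology inherited from the product topology. Beware that the type-class metric on
  \<^typ>\<open>nat \<Rightarrow> real\<close> is not the Euclidean one, hence the explicit balls below. The type-class topology
  (and so \<^const>\<open>borel\<close>) does restrict to the usual one on \<open>\<real>\<^sup>k\<close>.
\<close>

definition eball :: "nat \<Rightarrow> (nat \<Rightarrow> real) \<Rightarrow> real \<Rightarrow> (nat \<Rightarrow> real) set" where
  "eball k x r = {y \<in> topspace (Euclidean_space k). sqrt (\<Sum>i<k. (x i - y i)\<^sup>2) < r}"

definition borel_prob_on :: "(nat \<Rightarrow> real) set \<Rightarrow> (nat \<Rightarrow> real) measure \<Rightarrow> bool" where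
  "borel_prob_on F \<mu> \<longleftrightarrow> prob_space \<mu> \<and> sets \<mu> = sets (restrict_space borel F)"

definition semi_uniform ::
  "nat \<Rightarrow> (nat \<Rightarrow> real) set \<Rightarrow> (nat \<Rightarrow> real) measure \<Rightarrow> real \<Rightarrow> real \<Rightarrow> real \<Rightarrow> real \<Rightarrow> bool" where
  "semi_uniform k F \<mu> d \<delta>\<^sub>0 \<alpha> \<beta> \<longleftrightarrow>
     borel_prob_on F \<mu> \<and> 0 < \<delta>\<^sub>0 \<and> 0 < \<alpha> \<and> \<alpha> \<le> \<beta> \<and>
     (\<forall>x\<in>F. \<forall>\<delta>. 0 < \<delta> \<and> \<delta> < \<delta>\<^sub>0 \<longrightarrow>
        \<alpha> * \<delta> powr d \<le> measure \<mu> (eball k x \<delta> \<inter> F) \<and>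
        measure \<mu> (eball k x \<delta> \<inter> F) \<le> \<beta> * \<delta> powr d)"

text \<open>
  The probability that the union of the radius-\<open>r\<close> balls in \<open>\<real>\<^sup>k\<close> around \<open>m\<close> independent samples
  from \<open>\<mu>\<close> is connected; the samples are the coordinates \<open>X 1, \<dots>, X m\<close> on the product space.
\<close>

definition prob_connected :: "nat \<Rightarrow> (nat \<Rightarrow> real) measure \<Rightarrow> nat \<Rightarrow> real \<Rightarrow> real" where
  "prob_connected k \<mu> m r =
     \<P>(X in (\<Pi>\<^sub>M i\<in>{1..m}. \<mu>). connectedin (Euclidean_space k) (\<Union>i\<in>{1..m}. eball k (X i) r))"

end

theory Submission
  imports Defs "HOL-Real_Asymp.Real_Asymp"
begin

text \<open>
  The scale \<open>(ln m / m) powr (1 / d)\<close> is that of a coupon collector: at radius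
  \<open>s * (ln m / m) powr (1 / d)\<close> a ball has measure of order \<open>s powr d * ln m / m\<close>, so \<open>m\<close> samples all
  miss it with probability about \<open>m\<close> to the power \<open>- s powr d\<close> (up to the constants \<open>\<alpha>\<close>, \<open>\<beta>\<close>), while
  there are about \<open>m / ln m\<close> disjoint such balls. Hence for large \<open>s\<close> all balls are hit, and for small
  \<open>s\<close> many are not.

  For large radius, take a maximal separated set of centres in \<open>F\<close>. With high probability each
  of the balls about these centres contains a sample, so the sample balls of radius \<open>r\<close> cover \<open>F\<close>.
  Their union is then connected, since \<open>F\<close> is connected and every sample ball is connected and meets
  \<open>F\<close> (\<open>union_eballs_connected_if_cover\<close>, \<open>prob_connected_ge\<close>).

  For small radius, it suffices to find a sample with no other sample within \<open>2 * r\<close>. Fix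
  disjoint cells, each a ball with a concentric core, and look for a cell whose core contains a
  sample and which contains no other sample. The expected number of such isolated samples tends to
  infinity like a power of \<open>m\<close>, and the events are almost negatively correlated, so the second
  moment method shows that with high probability there is one (\<open>prob_no_isolated_cell_le\<close>,
  \<open>prob_connected_le\<close>). Working with fixed cells rather than with balls centred at the samples means
  that only probabilities of product boxes have to be computed.

  Numbers of centres are bounded above and below by comparing \<open>\<mu>\<close>-measures, so only \<open>d\<close>, \<open>\<alpha>\<close> and \<open>\<beta>\<close>
  enter the constants. Connectedness is a measurable event because it is equivalent to a finite
  combination of inequalities between distances of samples (\<open>union_eballs_connected_iff\<close>).
\<close>

section \<open>Euclidean distance and unions of balls\<close>

definition edist :: "nat \<Rightarrow> (nat \<Rightarrow> real) \<Rightarrow> (nat \<Rightarrow> real) \<Rightarrow> real" where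
  "edist k x y = sqrt (\<Sum>i<k. (x i - y i)\<^sup>2)"

lemma mem_eball: "y \<in> eball k x r \<longleftrightarrow> y \<in> topspace (Euclidean_space k) \<and> edist k x y < r"
  by (simp add: eball_def edist_def)

lemma edist_nonneg: "0 \<le> edist k x y"
  by (simp add: edist_def sum_nonneg)

lemma edist_self [simp]: "edist k x x = 0"
  by (simp add: edist_def)

lemma edist_commute: "edist k x y = edist k y x"
  by (simp add: edist_def power2_commute)

lemma edist_triangle: "edist k x z \<le> edist k x y + edist k y z"
  using L2_set_triangle_ineq[of "\<lambda>i. x i - y i" "\<lambda>i. y i - z i" "{..<k}"]
  by (simp add: edist_def L2_set_def)

lemma edist_convex_combination:
  assumes "0 \<le> t"
  shows "edist k x (\<lambda>i. x i + t * (y i - x i)) = t * edist k x y"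
proof -
  have "(\<Sum>i<k. (x i - (x i + t * (y i - x i)))\<^sup>2) = t\<^sup>2 * (\<Sum>i<k. (x i - y i)\<^sup>2)"
    unfolding sum_distrib_left by (intro sum.cong) (auto simp: power2_eq_square algebra_simps)
  then show ?thesis
    using assms by (simp add: edist_def real_sqrt_mult)
qed

lemma continuous_on_edist: "continuous_on UNIV (\<lambda>y. edist k x y)"
  unfolding edist_def by (intro continuous_intros continuous_on_product_coordinates)

lemma Euclidean_space_euclidean:
  "Euclidean_space k = subtopology euclidean (topspace (Euclidean_space k))"
  by (simp add: Euclidean_space_def euclidean_product_topology)

lemma openin_eball: "openin (Euclidean_space k) (eball k x r)"
proof -
  have "open {y. edist k x y < r}"
    by (intro open_Collect_less continuous_on_edist continuous_on_const)
  moreover have "eball k x r = topspace (Euclidean_space k) \<inter> {y. edist k x y < r}"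
    by (auto simp: mem_eball)
  ultimately show ?thesis
    by (subst Euclidean_space_euclidean) (simp add: openin_open_Int)
qed

text \<open>
  A ball is star-shaped about its centre. The type of points is not a real vector space,
  so the segments from the centre are written out as continuous images of the unit interval.
\<close>

lemma connectedin_eball:
  assumes x: "x \<in> topspace (Euclidean_space k)"
  shows "connectedin (Euclidean_space k) (eball k x r)"
proof (cases "r > 0")
  case False
  then have "eball k x r = {}"
    using order.strict_trans1[OF edist_nonneg[of k x]] by (auto simp: mem_eball)
  then show ?thesis by simp
next
  case True
  define seg where "seg y = (\<lambda>t i. x i + t * (y i - x i)) ` {0..1::real}" for y
  have cseg: "connected (seg y)" for y
    unfolding seg_def
    by (intro connected_continuous_image continuous_on_coordinatewise_then_product continuous_intros) simp
  have xseg: "x \<in> seg y" for y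
    unfolding seg_def by (rule image_eqI[of _ _ 0]) auto
  have yseg: "y \<in> seg y" for y
    unfolding seg_def by (rule image_eqI[of _ _ 1]) auto
  have sub: "seg y \<subseteq> eball k x r" if y: "y \<in> eball k x r" for y
  proof
    fix z assume "z \<in> seg y"
    then obtain t where t: "0 \<le> t" "t \<le> 1" "z = (\<lambda>i. x i + t * (y i - x i))"
      by (auto simp: seg_def)
    have "edist k x z = t * edist k x y"
      unfolding t(3) by (rule edist_convex_combination[OF t(1)])
    also have "\<dots> \<le> edist k x y"
      using t by (intro mult_left_le_one_le) (auto simp: edist_nonneg)
    also have "\<dots> < r" using y by (simp add: mem_eball)
    finally have "edist k x z < r" .
    moreover have "z \<in> topspace (Euclidean_space k)"
      using x y t by (auto simp: topspace_Euclidean_space mem_eball)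
    ultimately show "z \<in> eball k x r" by (simp add: mem_eball)
  qed
  have xin: "x \<in> eball k x r" using x True by (simp add: mem_eball)
  have eq: "eball k x r = \<Union>(seg ` eball k x r)"
    using sub yseg by blast
  have "connected (eball k x r)"
    by (subst eq, rule connected_Union) (use cseg xseg in blast)+
  then show ?thesis
    by (subst Euclidean_space_euclidean) (auto simp: connectedin_subtopology mem_eball)
qed

lemma eballs_meet_iff:
  assumes "x \<in> topspace (Euclidean_space k)" "y \<in> topspace (Euclidean_space k)"
  shows "eball k x r \<inter> eball k y r \<noteq> {} \<longleftrightarrow> edist k x y < 2 * r"
proof
  assume "eball k x r \<inter> eball k y r \<noteq> {}"
  then obtain z where "edist k x z < r" "edist k y z < r" by (auto simp: mem_eball)
  then show "edist k x y < 2 * r"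
    using edist_triangle[of k x y z] edist_commute[of k y z] by linarith
next
  assume less: "edist k x y < 2 * r"
  define z where "z = (\<lambda>i. x i + (1/2) * (y i - x i))"
  have z': "z = (\<lambda>i. y i + (1/2) * (x i - y i))"
    by (auto simp: z_def field_simps)
  have "edist k x z = (1/2) * edist k x y"
    unfolding z_def by (rule edist_convex_combination) simp
  moreover have "edist k y z = (1/2) * edist k y x"
    unfolding z' by (rule edist_convex_combination) simp
  moreover have "z \<in> topspace (Euclidean_space k)"
    using assms by (auto simp: z_def topspace_Euclidean_space)
  ultimately have "z \<in> eball k x r \<inter> eball k y r"
    using less edist_commute[of k x y] by (auto simp: mem_eball)
  then show "eball k x r \<inter> eball k y r \<noteq> {}" by blast
qed

text \<open>
  In any separation of the union each connected piece lies on one side, so a separation amounts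
  to a splitting of the index set into two parts whose pieces do not meet. This makes connectedness
  a finite combination of conditions on pairs of indices, and hence a measurable event when the
  pieces are random balls.
\<close>

lemma connectedin_UN_open_iff:
  assumes op: "\<And>i. i \<in> I \<Longrightarrow> openin T (U i)"
    and conn: "\<And>i. i \<in> I \<Longrightarrow> connectedin T (U i)"
    and ne: "\<And>i. i \<in> I \<Longrightarrow> U i \<noteq> {}"
  shows "connectedin T (\<Union>i\<in>I. U i) \<longleftrightarrow>
    (\<forall>S\<in>Pow I - {{}, I}. \<exists>i\<in>S. \<exists>j\<in>I - S. U i \<inter> U j \<noteq> {})" (is "?L \<longleftrightarrow> ?R")
proof
  assume L: ?L
  show ?R
  proof (rule ballI, rule ccontr)
    fix S assume S: "S \<in> Pow I - {{}, I}"
      and dis: "\<not> (\<exists>i\<in>S. \<exists>j\<in>I - S. U i \<inter> U j \<noteq> {})"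
    let ?A = "\<Union>i\<in>S. U i" and ?B = "\<Union>i\<in>I - S. U i"
    have "openin T ?A" "openin T ?B" using S by (auto intro!: openin_Union op)
    moreover have "(\<Union>i\<in>I. U i) \<subseteq> ?A \<union> ?B" by auto
    moreover have "?A \<inter> ?B \<inter> (\<Union>i\<in>I. U i) = {}" using dis by blast
    moreover have "?A \<inter> (\<Union>i\<in>I. U i) \<noteq> {}"
    proof -
      obtain i where "i \<in> S" "i \<in> I" using S by auto
      then show ?thesis using ne[of i] by blast
    qed
    moreover have "?B \<inter> (\<Union>i\<in>I. U i) \<noteq> {}"
    proof -
      obtain i where "i \<in> I - S" using S by auto
      then show ?thesis using ne[of i] by blast
    qed
    ultimately show False using L unfolding connectedin by metis
  qed
next
  assume R: ?R
  show ?L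
    unfolding connectedin
  proof (intro conjI notI)
    show "(\<Union>i\<in>I. U i) \<subseteq> topspace T" using op openin_subset by blast
  next
    let ?V = "\<Union>i\<in>I. U i"
    assume "\<exists>A B. openin T A \<and> openin T B \<and> ?V \<subseteq> A \<union> B \<and>
      A \<inter> B \<inter> ?V = {} \<and> A \<inter> ?V \<noteq> {} \<and> B \<inter> ?V \<noteq> {}"
    then obtain A B where AB: "openin T A" "openin T B" "?V \<subseteq> A \<union> B"
      "A \<inter> B \<inter> ?V = {}" "A \<inter> ?V \<noteq> {}" "B \<inter> ?V \<noteq> {}"
      by (elim exE conjE)
    have side: "A \<inter> U i = {} \<or> B \<inter> U i = {}" if "i \<in> I" for i
    proof (rule ccontr)
      assume "\<not> ?thesis"
      then have meets: "A \<inter> U i \<noteq> {}" "B \<inter> U i \<noteq> {}" by simp_all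
      have "U i \<subseteq> A \<union> B" "A \<inter> B \<inter> U i = {}" using AB(3,4) that by blast+
      with meets show False
        using conn[OF that] AB(1,2) unfolding connectedin by metis
    qed
    define S where "S = {i\<in>I. A \<inter> U i \<noteq> {}}"
    have "S \<noteq> {}" using AB(5) by (auto simp: S_def)
    moreover have "S \<noteq> I"
    proof -
      obtain i where "i \<in> I" "B \<inter> U i \<noteq> {}" using AB(6) by auto
      then have "i \<notin> S" using side by (auto simp: S_def)
      then show ?thesis using \<open>i \<in> I\<close> by blast
    qed
    ultimately have "S \<in> Pow I - {{}, I}" by (auto simp: S_def)
    from bspec[OF R this] obtain i j where ij: "i \<in> S" "j \<in> I - S" "U i \<inter> U j \<noteq> {}"
      by (elim bexE)
    then obtain z where z: "z \<in> U i" "z \<in> U j" by blast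
    have "z \<notin> A" using ij z by (auto simp: S_def)
    moreover have "z \<notin> B" using ij z side[of i] by (auto simp: S_def)
    ultimately show False using AB(3) z ij by blast
  qed
qed

lemma union_eballs_connected_iff:
  assumes "0 < r" and "\<And>i. i \<in> I \<Longrightarrow> X i \<in> topspace (Euclidean_space k)"
  shows "connectedin (Euclidean_space k) (\<Union>i\<in>I. eball k (X i) r) \<longleftrightarrow>
    (\<forall>S\<in>Pow I - {{}, I}. \<exists>i\<in>S. \<exists>j\<in>I - S. edist k (X i) (X j) < 2 * r)"
proof -
  have "connectedin (Euclidean_space k) (\<Union>i\<in>I. eball k (X i) r) \<longleftrightarrow>
    (\<forall>S\<in>Pow I - {{}, I}. \<exists>i\<in>S. \<exists>j\<in>I - S. eball k (X i) r \<inter> eball k (X j) r \<noteq> {})"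
  proof (rule connectedin_UN_open_iff)
    fix i assume "i \<in> I"
    then have "X i \<in> eball k (X i) r" using assms by (simp add: mem_eball)
    then show "eball k (X i) r \<noteq> {}" by blast
  qed (use assms in \<open>auto intro: openin_eball connectedin_eball\<close>)
  also have "\<dots> \<longleftrightarrow> (\<forall>S\<in>Pow I - {{}, I}. \<exists>i\<in>S. \<exists>j\<in>I - S. edist k (X i) (X j) < 2 * r)"
    using assms by (intro ball_cong bex_cong refl eballs_meet_iff) auto
  finally show ?thesis .
qed

text \<open>
  The connected set \<open>F\<close> glues the balls together: all the sets \<open>F \<union> eball k (X i) r\<close> are connected
  and share \<open>F\<close>.
\<close>

lemma union_eballs_connected_if_cover:
  assumes F: "connectedin (Euclidean_space k) F" "F \<noteq> {}"
    and r: "0 < r" and X: "\<And>i. i \<in> I \<Longrightarrow> X i \<in> F"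
    and cover: "F \<subseteq> (\<Union>i\<in>I. eball k (X i) r)"
  shows "connectedin (Euclidean_space k) (\<Union>i\<in>I. eball k (X i) r)"
proof -
  have FT: "F \<subseteq> topspace (Euclidean_space k)" using F connectedin_subset_topspace by blast
  have mem: "X i \<in> eball k (X i) r" if "i \<in> I" for i
    using that X[OF that] r FT by (auto simp: mem_eball)
  have "I \<noteq> {}" using F cover by auto
  have eq: "(\<Union>i\<in>I. eball k (X i) r) = \<Union>((\<lambda>i. F \<union> eball k (X i) r) ` I)"
    using cover \<open>I \<noteq> {}\<close> by blast
  show ?thesis
    unfolding eq
  proof (rule connectedin_Union)
    fix S assume "S \<in> (\<lambda>i. F \<union> eball k (X i) r) ` I"
    then obtain i where i: "i \<in> I" "S = F \<union> eball k (X i) r" by blast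
    have "connectedin (Euclidean_space k) (F \<union> eball k (X i) r)"
      using X[OF i(1)] mem[OF i(1)] FT
      by (intro connectedin_Un F connectedin_eball) auto
    then show "connectedin (Euclidean_space k) S" using i by simp
  qed (use F in blast)
qed

section \<open>Second moment bounds\<close>

text \<open>
  Chebyshev's inequality for the number \<open>Y\<close> of events that occur, whose mean is \<open>S\<close>: on the event
  that none occurs, \<open>(Y - S)\<^sup>2 = S\<^sup>2\<close>.
\<close>

lemma (in prob_space) prob_none_le_second_moment:
  assumes A: "finite A" and E: "\<And>a. a \<in> A \<Longrightarrow> E a \<in> events"
    and S: "S = (\<Sum>a\<in>A. prob (E a))" "0 < S"
    and pairs: "(\<Sum>a\<in>A. \<Sum>b\<in>A - {a}. prob (E a \<inter> E b)) \<le> K * S\<^sup>2"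
  shows "prob (space M - (\<Union>a\<in>A. E a)) \<le> 1 / S + K - 1"
proof -
  let ?N = "space M - (\<Union>a\<in>A. E a)"
  define Y where "Y \<omega> = (\<Sum>a\<in>A. indicator (E a) \<omega> :: real)" for \<omega>
  have N: "?N \<in> events" using A E by auto
  have iE: "integrable M (indicator B :: _ \<Rightarrow> real)" if "B \<in> events" for B
    using that by (simp add: emeasure_eq_measure)
  have intY: "integrable M Y"
    unfolding Y_def using E by (intro Bochner_Integration.integrable_sum iE)
  have EY: "expectation Y = S"
    unfolding Y_def S(1)
    by (subst Bochner_Integration.integral_sum) (use E iE in auto)
  have Y2: "(Y \<omega>)\<^sup>2 = (\<Sum>a\<in>A. \<Sum>b\<in>A. indicator (E a \<inter> E b) \<omega>)" for \<omega>
    unfolding Y_def power2_eq_square sum_product by (simp add: indicator_inter_arith)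
  have intY2: "integrable M (\<lambda>\<omega>. (Y \<omega>)\<^sup>2)"
    unfolding Y2 using E by (intro Bochner_Integration.integrable_sum iE) auto
  have "expectation (\<lambda>\<omega>. (Y \<omega>)\<^sup>2) = (\<Sum>a\<in>A. \<Sum>b\<in>A. prob (E a \<inter> E b))"
    unfolding Y2 using E by (subst Bochner_Integration.integral_sum; (intro Bochner_Integration.integrable_sum iE sum.cong)?)
      (auto simp: Bochner_Integration.integral_sum iE)
  also have "\<dots> = (\<Sum>a\<in>A. prob (E a) + (\<Sum>b\<in>A - {a}. prob (E a \<inter> E b)))"
    using A by (intro sum.cong refl) (simp add: sum.remove)
  also have "\<dots> \<le> S + K * S\<^sup>2"
    using pairs by (simp add: sum.distrib S(1))
  finally have EY2: "expectation (\<lambda>\<omega>. (Y \<omega>)\<^sup>2) \<le> S + K * S\<^sup>2" .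
  have le: "S\<^sup>2 * indicator ?N \<omega> \<le> (Y \<omega>)\<^sup>2 - 2 * S * Y \<omega> + S\<^sup>2" if "\<omega> \<in> space M" for \<omega>
  proof (cases "\<omega> \<in> ?N")
    case True
    then have "Y \<omega> = 0" by (auto simp: Y_def indicator_def)
    then show ?thesis using True by simp
  next
    case False
    have "(Y \<omega>)\<^sup>2 - 2 * S * Y \<omega> + S\<^sup>2 = (Y \<omega> - S)\<^sup>2" by (simp add: power2_diff algebra_simps)
    then show ?thesis using False by simp
  qed
  have "S\<^sup>2 * prob ?N = expectation (\<lambda>\<omega>. S\<^sup>2 * indicator ?N \<omega>)"
    using N by simp
  also have "\<dots> \<le> expectation (\<lambda>\<omega>. (Y \<omega>)\<^sup>2 - 2 * S * Y \<omega> + S\<^sup>2)"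
    using le N intY intY2
    by (intro integral_mono Bochner_Integration.integrable_add Bochner_Integration.integrable_diff
        integrable_mult_right iE) auto
  also have "\<dots> = expectation (\<lambda>\<omega>. (Y \<omega>)\<^sup>2) - 2 * S * S + S\<^sup>2"
    using intY intY2 EY by (simp add: prob_space)
  also have "\<dots> \<le> S + K * S\<^sup>2 - S\<^sup>2"
    using EY2 by (simp add: power2_eq_square)
  also have "\<dots> = S\<^sup>2 * (1 / S + K - 1)"
    using S(2) by (simp add: power2_eq_square field_simps)
  finally show ?thesis using S(2) by simp
qed

lemma measure_PiM_iid_box:
  assumes "prob_space M" "finite I" "\<And>i. i \<in> I \<Longrightarrow> A i \<in> sets M"
  shows "measure (\<Pi>\<^sub>M i\<in>I. M) (Pi\<^sub>E I A) = (\<Prod>i\<in>I. measure M (A i))"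
proof -
  interpret M: prob_space M by fact
  interpret P: product_prob_space "\<lambda>_. M" I ..
  have "prod_emb I (\<lambda>_. M) I (Pi\<^sub>E I A) = Pi\<^sub>E I A"
    using assms sets.sets_into_space by (intro prod_emb_PiE_same_index) auto
  then show ?thesis
    using P.measure_PiM_emb[of I A] assms by simp
qed

text \<open>
  A sample is isolated if it falls in the core of a cell while every other sample misses the whole
  cell. Fixing the cells in advance turns the event that sample \<open>i\<close> is isolated in cell \<open>j\<close> into a
  box of the product space, with an explicit probability. Two such events with distinct samples and
  disjoint cells are nearly negatively correlated, because
  \<open>1 - u - v \<le> (1 - u) * (1 - v)\<close>. Only \<open>card I - 2\<close> samples are then confined to complements of
  cells, and the factor \<open>1 / (1 - b)\<^sup>2\<close> restores the exponent \<open>card I - 1\<close> of both single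
  probabilities. Every other pair of distinct events is incompatible.
\<close>

lemma (in prob_space) prob_no_isolated_cell_le:
  fixes I :: "'i set" and T :: "'t set"
  assumes I: "finite I" "2 \<le> card I" and T: "finite T"
    and core: "\<And>j. j \<in> T \<Longrightarrow> core j \<in> events" and big: "\<And>j. j \<in> T \<Longrightarrow> big j \<in> events"
    and sub: "\<And>j. j \<in> T \<Longrightarrow> core j \<subseteq> big j" and disj: "disjoint_family_on big T"
    and b: "\<And>j. j \<in> T \<Longrightarrow> prob (big j) \<le> b" "b < 1"
    and S: "S = real (card I) * (\<Sum>j\<in>T. prob (core j) * (1 - prob (big j)) ^ (card I - 1))" "0 < S"
  shows "measure (\<Pi>\<^sub>M i\<in>I. M) {X \<in> space (\<Pi>\<^sub>M i\<in>I. M).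
      \<not> (\<exists>i\<in>I. \<exists>j\<in>T. X i \<in> core j \<and> (\<forall>l\<in>I - {i}. X l \<notin> big j))} \<le> 1 / S + 1 / (1 - b)\<^sup>2 - 1"
proof -
  let ?P = "\<Pi>\<^sub>M i\<in>I. M"
  interpret P: prob_space ?P by (intro prob_space_PiM) (rule prob_space_axioms)
  define n where "n = card I - 2"
  have n: "card I = Suc (Suc n)" using I(2) by (simp add: n_def)
  define w where "w j = prob (core j) * (1 - prob (big j)) ^ Suc n" for j
  have w0: "0 \<le> w j" for j by (simp add: w_def)
  define box where "box i j l = (if l = i then core j else space M - big j)" for i j and l :: 'i
  define E where "E = (\<lambda>(i, j). Pi\<^sub>E I (box i j))"
  have box: "box i j l \<in> events" if "j \<in> T" for i j l
    using that core big by (auto simp: box_def)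
  have E_sets: "E a \<in> P.events" if "a \<in> I \<times> T" for a
    using that I box by (auto simp: E_def intro!: sets_PiM_I_finite)
  have prob_E: "P.prob (E (i, j)) = w j" if "i \<in> I" "j \<in> T" for i j
  proof -
    have "P.prob (E (i, j)) = (\<Prod>l\<in>I. prob (box i j l))"
      unfolding E_def using that box I by (simp add: measure_PiM_iid_box[OF prob_space_axioms])
    also have "\<dots> = prob (core j) * (\<Prod>l\<in>I - {i}. 1 - prob (big j))"
      using that I big by (subst prod.remove[of _ i]) (auto simp: box_def prob_compl)
    also have "\<dots> = w j" using that I n by (simp add: w_def)
    finally show ?thesis .
  qed
  have S_eq: "S = (\<Sum>a\<in>I \<times> T. P.prob (E a))"
  proof -
    have "(\<Sum>a\<in>I \<times> T. P.prob (E a)) = (\<Sum>i\<in>I. \<Sum>j\<in>T. w j)"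
      unfolding sum.cartesian_product' by (intro sum.cong refl) (simp add: prob_E)
    then show ?thesis by (simp add: S(1) w_def n)
  qed
  have pair: "P.prob (E (i, j) \<inter> E (i', j')) \<le> w j * w j' / (1 - b)\<^sup>2"
    if ij: "i \<in> I" "j \<in> T" "i' \<in> I" "j' \<in> T" "(i, j) \<noteq> (i', j')" for i j i' j'
  proof (cases "i = i' \<or> j = j'")
    case True
    have "E (i, j) \<inter> E (i', j') = {}"
    proof (rule ccontr)
      assume "\<not> ?thesis"
      then obtain X where X: "X \<in> Pi\<^sub>E I (box i j)" "X \<in> Pi\<^sub>E I (box i' j')"
        by (auto simp: E_def)
      have "X i \<in> box i j i" "X i \<in> box i' j' i" using X ij by auto
      then have *: "X i \<in> core j" "X i \<in> (if i = i' then core j' else space M - big j')"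
        by (simp_all add: box_def)
      show False
      proof (cases "i = i'")
        case True
        then have "j \<noteq> j'" using ij by simp
        moreover have "X i \<in> big j \<inter> big j'" using * True sub ij by auto
        ultimately show False using disj ij by (auto simp: disjoint_family_on_def)
      next
        case False
        then show False using * \<open>i = i' \<or> j = j'\<close> sub ij by auto
      qed
    qed
    then show ?thesis using w0 by simp
  next
    case False
    \<comment> \<open>For distinct samples and distinct cells, both events together confine the samples to this box.\<close>
    define D where "D l = (if l = i then core j else if l = i' then core j'
      else space M - (big j \<union> big j'))" for l
    have D: "D l \<in> events" for l using ij core big by (auto simp: D_def)
    have "E (i, j) \<inter> E (i', j') \<subseteq> Pi\<^sub>E I D"
    proof
      fix X assume "X \<in> E (i, j) \<inter> E (i', j')"
      then have X: "X \<in> Pi\<^sub>E I (box i j)" "X \<in> Pi\<^sub>E I (box i' j')" by (simp_all add: E_def)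
      have "X l \<in> D l" if "l \<in> I" for l
        using PiE_mem[OF X(1) that] PiE_mem[OF X(2) that] False
        by (cases "l = i"; cases "l = i'") (simp_all add: box_def D_def)
      moreover have "X \<in> extensional I" using X(1) by (simp add: PiE_iff)
      ultimately show "X \<in> Pi\<^sub>E I D" by (simp add: PiE_iff)
    qed
    then have "P.prob (E (i, j) \<inter> E (i', j')) \<le> P.prob (Pi\<^sub>E I D)"
      using D I by (intro P.finite_measure_mono sets_PiM_I_finite) auto
    also have "\<dots> = (\<Prod>l\<in>I. prob (D l))"
      using D I by (simp add: measure_PiM_iid_box[OF prob_space_axioms])
    also have "\<dots> = prob (core j) * (prob (core j') * (\<Prod>l\<in>I - {i} - {i'}. prob (D l)))"
      using ij I False by (subst prod.remove[of _ i], simp, simp, subst prod.remove[of _ i']) (auto simp: D_def)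
    also have "(\<Prod>l\<in>I - {i} - {i'}. prob (D l)) = prob (space M - (big j \<union> big j')) ^ n"
    proof -
      have "card (I - {i} - {i'}) = card (I - {i}) - 1"
        using ij False by (intro card_Diff_singleton) auto
      then have "card (I - {i} - {i'}) = n"
        using card_Diff_singleton[OF ij(1)] n by simp
      moreover have "(\<Prod>l\<in>I - {i} - {i'}. prob (D l)) = (\<Prod>l\<in>I - {i} - {i'}. prob (space M - (big j \<union> big j')))"
        by (intro prod.cong) (auto simp: D_def)
      ultimately show ?thesis by simp
    qed
    also have "\<dots> \<le> ((1 - prob (big j)) * (1 - prob (big j'))) ^ n"
    proof (intro power_mono)
      have "prob (space M - (big j \<union> big j')) = 1 - (prob (big j) + prob (big j'))"
        using ij big disj False
        by (subst prob_compl) (auto simp: finite_measure_Union disjoint_family_on_def)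
      also have "\<dots> \<le> (1 - prob (big j)) * (1 - prob (big j'))"
        by (simp add: algebra_simps)
      finally show "prob (space M - (big j \<union> big j')) \<le> (1 - prob (big j)) * (1 - prob (big j'))" .
    qed simp
    finally have "P.prob (E (i, j) \<inter> E (i', j')) \<le>
        prob (core j) * (prob (core j') * ((1 - prob (big j)) * (1 - prob (big j'))) ^ n)"
      by (simp add: mult_left_mono)
    also have "\<dots> = (prob (core j) * (1 - prob (big j)) ^ n) * (prob (core j') * (1 - prob (big j')) ^ n)"
      by (simp add: power_mult_distrib)
    also have "\<dots> \<le> (w j / (1 - b)) * (w j' / (1 - b))"
    proof -
      have "prob (core j) * (1 - prob (big j)) ^ n \<le> w j / (1 - b)" if "j \<in> T" for j
      proof -
        have "(prob (core j) * (1 - prob (big j)) ^ n) * (1 - b) \<le>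
            (prob (core j) * (1 - prob (big j)) ^ n) * (1 - prob (big j))"
          using b(1)[OF that] by (intro mult_left_mono) auto
        then show ?thesis using b(2) by (simp add: w_def pos_le_divide_eq mult_ac)
      qed
      then show ?thesis using ij w0 b(2) by (intro mult_mono) auto
    qed
    finally show ?thesis by (simp add: power2_eq_square)
  qed
  have "(\<Sum>a\<in>I \<times> T. \<Sum>p\<in>I \<times> T - {a}. P.prob (E a \<inter> E p)) \<le>
      (\<Sum>a\<in>I \<times> T. \<Sum>p\<in>I \<times> T - {a}. w (snd a) * w (snd p) / (1 - b)\<^sup>2)"
  proof (intro sum_mono)
    fix a p assume ap: "a \<in> I \<times> T" "p \<in> I \<times> T - {a}"
    obtain i j i' j' where "a = (i, j)" "p = (i', j')" by (metis surj_pair)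
    then show "P.prob (E a \<inter> E p) \<le> w (snd a) * w (snd p) / (1 - b)\<^sup>2"
      using pair[of i j i' j'] ap by auto
  qed
  also have "\<dots> \<le> (\<Sum>a\<in>I \<times> T. \<Sum>p\<in>I \<times> T. w (snd a) * w (snd p) / (1 - b)\<^sup>2)"
    using w0 I T by (intro sum_mono sum_mono2) auto
  also have "\<dots> = (\<Sum>a\<in>I \<times> T. w (snd a)) * (\<Sum>a\<in>I \<times> T. w (snd a)) / (1 - b)\<^sup>2"
    by (simp add: sum_product sum_divide_distrib)
  also have "(\<Sum>a\<in>I \<times> T. w (snd a)) = S"
    unfolding S_eq by (intro sum.cong) (auto simp: prob_E)
  finally have "(\<Sum>a\<in>I \<times> T. \<Sum>p\<in>I \<times> T - {a}. P.prob (E a \<inter> E p)) \<le> 1 / (1 - b)\<^sup>2 * S\<^sup>2"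
    by (simp add: power2_eq_square)
  from P.prob_none_le_second_moment[OF _ E_sets S_eq S(2) this]
  have "P.prob (space ?P - (\<Union>a\<in>I \<times> T. E a)) \<le> 1 / S + 1 / (1 - b)\<^sup>2 - 1"
    using I T by simp
  moreover have "{X \<in> space ?P. \<not> (\<exists>i\<in>I. \<exists>j\<in>T. X i \<in> core j \<and> (\<forall>l\<in>I - {i}. X l \<notin> big j))}
      = space ?P - (\<Union>a\<in>I \<times> T. E a)" (is "?L = ?R")
  proof (rule set_eqI)
    fix X
    show "X \<in> ?L \<longleftrightarrow> X \<in> ?R"
    proof (cases "X \<in> space ?P")
      case True
      have "X \<in> E (i, j) \<longleftrightarrow> X i \<in> core j \<and> (\<forall>l\<in>I - {i}. X l \<notin> big j)" if "i \<in> I" for i j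
        using True that by (auto simp: E_def box_def space_PiM PiE_iff)
      then show ?thesis using True by auto
    qed simp
  qed
  ultimately show ?thesis by simp
qed

section \<open>Semi-uniform measures\<close>

locale semi_uniform_measure =
  fixes k :: nat and F :: "(nat \<Rightarrow> real) set" and \<mu> :: "(nat \<Rightarrow> real) measure"
    and d \<delta>\<^sub>0 \<alpha> \<beta> :: real
  assumes semi: "semi_uniform k F \<mu> d \<delta>\<^sub>0 \<alpha> \<beta>"
    and F_subset: "F \<subseteq> topspace (Euclidean_space k)"
begin

sublocale prob_space \<mu>
  using semi by (simp add: semi_uniform_def borel_prob_on_def)

lemma sets_\<mu>: "sets \<mu> = sets (restrict_space borel F)"
  using semi by (simp add: semi_uniform_def borel_prob_on_def)

lemma space_\<mu> [simp]: "space \<mu> = F"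
  using sets_eq_imp_space_eq[OF sets_\<mu>] by (simp add: space_restrict_space)

lemma F_nonempty: "F \<noteq> {}"
  using not_empty by simp

lemma \<delta>\<^sub>0_pos: "0 < \<delta>\<^sub>0" and \<alpha>_pos: "0 < \<alpha>" and \<beta>_pos: "0 < \<beta>"
  using semi by (auto simp: semi_uniform_def)

lemma ball_lower: "x \<in> F \<Longrightarrow> 0 < s \<Longrightarrow> s < \<delta>\<^sub>0 \<Longrightarrow> \<alpha> * s powr d \<le> prob (eball k x s \<inter> F)"
  and ball_upper: "x \<in> F \<Longrightarrow> 0 < s \<Longrightarrow> s < \<delta>\<^sub>0 \<Longrightarrow> prob (eball k x s \<inter> F) \<le> \<beta> * s powr d"
  using semi by (auto simp: semi_uniform_def)

lemma measurable_coordinate: "(\<lambda>x. x i) \<in> borel_measurable \<mu>"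
  unfolding measurable_cong_sets[OF sets_\<mu> refl]
  by (intro measurable_restrict_space1 measurable_product_coordinates)

lemma eball_inter_eq: "eball k x s \<inter> F = {y\<in>F. edist k x y < s}"
  using F_subset by (auto simp: mem_eball)

lemma sets_eball: "eball k x s \<inter> F \<in> events"
proof -
  have [measurable]: "(\<lambda>y. edist k x y) \<in> borel_measurable \<mu>"
    unfolding edist_def using measurable_coordinate by measurable
  have "{y\<in>space \<mu>. edist k x y < s} \<in> events" by measurable
  then show ?thesis by (simp add: eball_inter_eq)
qed

lemma measurable_edist_samples:
  assumes "i \<in> I" "j \<in> I"
  shows "(\<lambda>X. edist k (X i) (X j)) \<in> borel_measurable (\<Pi>\<^sub>M i\<in>I. \<mu>)"
proof -
  have [measurable]: "(\<lambda>X. X a n) \<in> borel_measurable (\<Pi>\<^sub>M i\<in>I. \<mu>)" if "a \<in> I" for a n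
    by (rule measurable_compose[OF measurable_component_singleton[OF that] measurable_coordinate])
  show ?thesis
    unfolding edist_def using assms by measurable
qed

text \<open>
  Needed for the lower bound on the probability: the measure of a set outside the sigma-algebra
  would be \<open>0\<close>, whatever it contains.
\<close>

lemma sets_connected:
  assumes "finite I" "0 < r"
  shows "{X \<in> space (\<Pi>\<^sub>M i\<in>I. \<mu>). connectedin (Euclidean_space k) (\<Union>i\<in>I. eball k (X i) r)}
    \<in> sets (\<Pi>\<^sub>M i\<in>I. \<mu>)"
proof -
  let ?P = "\<Pi>\<^sub>M i\<in>I. \<mu>"
  have fin: "finite S" if "S \<in> Pow I - {{}, I}" for S
    using assms that finite_subset by auto
  have "{X \<in> space ?P. \<forall>S\<in>Pow I - {{}, I}. \<exists>i\<in>S. \<exists>j\<in>I - S. edist k (X i) (X j) < 2 * r} \<in> sets ?P"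
  proof (intro sets.sets_Collect_finite_All sets.sets_Collect_finite_Ex)
    fix S i j assume "S \<in> Pow I - {{}, I}" "i \<in> S" "j \<in> I - S"
    then have [measurable]: "(\<lambda>X. edist k (X i) (X j)) \<in> borel_measurable ?P"
      by (intro measurable_edist_samples) auto
    show "{X \<in> space ?P. edist k (X i) (X j) < 2 * r} \<in> sets ?P" by measurable
  qed (use assms fin in auto)
  also have "{X \<in> space ?P. \<forall>S\<in>Pow I - {{}, I}. \<exists>i\<in>S. \<exists>j\<in>I - S. edist k (X i) (X j) < 2 * r} =
    {X \<in> space ?P. connectedin (Euclidean_space k) (\<Union>i\<in>I. eball k (X i) r)}"
  proof (intro Collect_cong conj_cong refl)
    fix X assume "X \<in> space ?P"
    then have X: "X i \<in> topspace (Euclidean_space k)" if "i \<in> I" for i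
      using that F_subset by (auto simp: space_PiM PiE_iff)
    show "(\<forall>S\<in>Pow I - {{}, I}. \<exists>i\<in>S. \<exists>j\<in>I - S. edist k (X i) (X j) < 2 * r) \<longleftrightarrow>
      connectedin (Euclidean_space k) (\<Union>i\<in>I. eball k (X i) r)"
      by (rule union_eballs_connected_iff[OF assms(2) X, symmetric])
  qed
  finally show ?thesis .
qed

definition separated :: "real \<Rightarrow> (nat \<Rightarrow> real) set \<Rightarrow> bool" where
  "separated s T \<longleftrightarrow> (\<forall>x\<in>T. \<forall>y\<in>T. x \<noteq> y \<longrightarrow> s \<le> edist k x y)"

lemma disjoint_half_balls:
  assumes "separated s T"
  shows "disjoint_family_on (\<lambda>x. eball k x (s / 2) \<inter> F) T"
  unfolding disjoint_family_on_def
proof (intro ballI impI, rule ccontr)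
  fix x y assume xy: "x \<in> T" "y \<in> T" "x \<noteq> y" "eball k x (s / 2) \<inter> F \<inter> (eball k y (s / 2) \<inter> F) \<noteq> {}"
  then obtain z where "edist k x z < s / 2" "edist k y z < s / 2" by (auto simp: mem_eball)
  then have "edist k x y < s"
    using edist_triangle[of k x y z] edist_commute[of k y z] by linarith
  then show False using assms xy by (force simp: separated_def)
qed

text \<open>
  Counting a separated set or a cover through \<open>\<mu>\<close> instead of through volume is what keeps the
  constants independent of the ambient dimension \<open>k\<close>.
\<close>

lemma card_separated_le:
  assumes "separated s T" "finite T" "T \<subseteq> F" "0 < s" "s / 2 < \<delta>\<^sub>0"
  shows "real (card T) * (\<alpha> * (s / 2) powr d) \<le> 1"
proof -
  have "real (card T) * (\<alpha> * (s / 2) powr d) = (\<Sum>x\<in>T. \<alpha> * (s / 2) powr d)" by simp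
  also have "\<dots> \<le> (\<Sum>x\<in>T. prob (eball k x (s / 2) \<inter> F))"
    using assms by (intro sum_mono ball_lower) auto
  also have "\<dots> = prob (\<Union>x\<in>T. eball k x (s / 2) \<inter> F)"
    using assms disjoint_half_balls sets_eball
    by (intro finite_measure_finite_Union[symmetric]) auto
  also have "\<dots> \<le> 1" by simp
  finally show ?thesis .
qed

lemma card_cover_ge:
  assumes "finite T" "T \<subseteq> F" "F \<subseteq> (\<Union>x\<in>T. eball k x s)" "0 < s" "s < \<delta>\<^sub>0"
  shows "1 \<le> real (card T) * (\<beta> * s powr d)"
proof -
  have "1 = prob F" using prob_space by simp
  also have "F = (\<Union>x\<in>T. eball k x s \<inter> F)" using assms by blast
  also have "prob \<dots> \<le> (\<Sum>x\<in>T. prob (eball k x s \<inter> F))"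
    using assms sets_eball by (intro finite_measure_subadditive_finite) auto
  also have "\<dots> \<le> (\<Sum>x\<in>T. \<beta> * s powr d)"
    using assms by (intro sum_mono ball_upper) auto
  finally show ?thesis by simp
qed

text \<open>
  A separated set of largest cardinality cannot be enlarged, so every point is closer than \<open>s\<close>
  to it; the packing bound guarantees that a largest one exists.
\<close>

lemma exists_separated_cover:
  assumes s: "0 < s" "s / 2 < \<delta>\<^sub>0"
  obtains T where "finite T" "T \<subseteq> F" "separated s T" "F \<subseteq> (\<Union>x\<in>T. eball k x s)"
proof -
  let ?Q = "\<lambda>T. finite T \<and> T \<subseteq> F \<and> separated s T"
  define N where "N = nat \<lceil>1 / (\<alpha> * (s / 2) powr d)\<rceil>"
  have "card T \<le> N" if "?Q T" for T
  proof -
    have pos: "0 < \<alpha> * (s / 2) powr d" using \<alpha>_pos s by simp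
    have "real (card T) \<le> 1 / (\<alpha> * (s / 2) powr d)"
      using card_separated_le[of s T] that s pos by (simp add: pos_le_divide_eq)
    then show ?thesis unfolding N_def by linarith
  qed
  then have bounded: "\<forall>T. ?Q T \<longrightarrow> card T < Suc N"
    by (simp add: less_Suc_eq_le)
  have "?Q {}" by (simp add: separated_def)
  from ex_has_greatest_nat[of ?Q, OF this bounded]
  obtain T where T: "finite T" "T \<subseteq> F" "separated s T" and max: "\<forall>T'. ?Q T' \<longrightarrow> card T' \<le> card T"
    by (elim exE conjE)
  have "F \<subseteq> (\<Union>x\<in>T. eball k x s)"
  proof (rule ccontr)
    assume "\<not> ?thesis"
    then obtain x where x: "x \<in> F" "x \<notin> (\<Union>x\<in>T. eball k x s)" by blast
    then have far: "s \<le> edist k y x" if "y \<in> T" for y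
      using that F_subset by (auto simp: mem_eball not_less)
    then have "x \<notin> T" using s by fastforce
    moreover have "?Q (insert x T)"
      using T x far edist_commute[of k x] by (auto simp: separated_def)
    ultimately show False using max[rule_format, of "insert x T"] T by simp
  qed
  then show thesis using that T by simp
qed

text \<open>
  If every ball of radius \<open>\<rho>\<close> about the points of a maximal \<open>\<rho>\<close>-separated set contains a sample, then
  each point of \<open>F\<close> is within \<open>2 * \<rho> \<le> r\<close> of a sample, so the sample balls cover \<open>F\<close>. By the packing bound there
  are at most \<open>1 / (\<alpha> * (\<rho> / 2) powr d)\<close> such points, and the samples all miss a given one of these
  balls with probability at most \<open>(1 - \<alpha> * \<rho> powr d) ^ m\<close>.
\<close>

lemma prob_connected_ge:
  assumes F: "connectedin (Euclidean_space k) F"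
    and \<rho>: "0 < \<rho>" "\<rho> < \<delta>\<^sub>0" and r: "2 * \<rho> \<le> r"
  shows "prob_connected k \<mu> m r \<ge> 1 - exp (- real m * (\<alpha> * \<rho> powr d)) / (\<alpha> * (\<rho> / 2) powr d)"
proof -
  let ?I = "{1..m}" and ?P = "\<Pi>\<^sub>M i\<in>{1..m}. \<mu>"
  interpret P: prob_space ?P by (intro prob_space_PiM) (rule prob_space_axioms)
  obtain T where T: "finite T" "T \<subseteq> F" "separated \<rho> T" "F \<subseteq> (\<Union>x\<in>T. eball k x \<rho>)"
    using exists_separated_cover[of \<rho>] \<rho> by auto
  define miss where "miss x = Pi\<^sub>E ?I (\<lambda>_. F - eball k x \<rho> \<inter> F)" for x
  have compl: "F - eball k x \<rho> \<inter> F \<in> events" for x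
    using sets.compl_sets[OF sets_eball[of x \<rho>]] by simp
  have miss: "miss x \<in> P.events" for x
    unfolding miss_def using compl by (intro sets_PiM_I_finite) auto
  let ?C = "{X \<in> space ?P. connectedin (Euclidean_space k) (\<Union>i\<in>?I. eball k (X i) r)}"
  have C: "?C \<in> P.events" using \<rho> r by (intro sets_connected) auto
  have incl: "space ?P - ?C \<subseteq> (\<Union>x\<in>T. miss x)"
  proof (rule subsetI, rule ccontr)
    fix X assume X: "X \<in> space ?P - ?C" and not_miss: "X \<notin> (\<Union>x\<in>T. miss x)"
    have XF: "X i \<in> F" if "i \<in> ?I" for i using X that by (auto simp: space_PiM PiE_iff)
    have hit: "\<exists>i\<in>?I. X i \<in> eball k x \<rho>" if "x \<in> T" for x
      using not_miss that X by (auto simp: miss_def space_PiM PiE_iff)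
    have "F \<subseteq> (\<Union>i\<in>?I. eball k (X i) r)"
    proof
      fix y assume y: "y \<in> F"
      then obtain x where x: "x \<in> T" "edist k x y < \<rho>" using T(4) by (auto simp: mem_eball)
      then obtain i where i: "i \<in> ?I" "edist k x (X i) < \<rho>" using hit[OF x(1)]
        unfolding mem_eball by blast
      have "edist k (X i) y < r"
        using x i r edist_triangle[of k "X i" y x] edist_commute[of k x "X i"] by linarith
      then show "y \<in> (\<Union>i\<in>?I. eball k (X i) r)"
        using i y F_subset by (auto simp: mem_eball)
    qed
    then have "connectedin (Euclidean_space k) (\<Union>i\<in>?I. eball k (X i) r)"
      using F F_nonempty \<rho> r XF by (intro union_eballs_connected_if_cover) auto
    then show False using X by simp
  qed
  have "P.prob (miss x) \<le> exp (- real m * (\<alpha> * \<rho> powr d))" if "x \<in> T" for x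
  proof -
    have "P.prob (miss x) = (1 - prob (eball k x \<rho> \<inter> F)) ^ m"
      unfolding miss_def using compl prob_compl[OF sets_eball[of x \<rho>]]
      by (simp add: measure_PiM_iid_box[OF prob_space_axioms])
    also have "\<dots> \<le> exp (- (\<alpha> * \<rho> powr d)) ^ m"
    proof (intro power_mono)
      have "1 - prob (eball k x \<rho> \<inter> F) \<le> 1 - \<alpha> * \<rho> powr d"
        using ball_lower that T \<rho> by auto
      also have "\<dots> \<le> exp (- (\<alpha> * \<rho> powr d))"
        using exp_ge_add_one_self[of "- (\<alpha> * \<rho> powr d)"] by simp
      finally show "1 - prob (eball k x \<rho> \<inter> F) \<le> exp (- (\<alpha> * \<rho> powr d))" .
    qed simp
    also have "\<dots> = exp (- real m * (\<alpha> * \<rho> powr d))"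
      by (simp add: exp_of_nat_mult[symmetric])
    finally show ?thesis .
  qed
  then have "(\<Sum>x\<in>T. P.prob (miss x)) \<le> real (card T) * exp (- real m * (\<alpha> * \<rho> powr d))"
    using sum_bounded_above[of T "\<lambda>x. P.prob (miss x)"] by simp
  also have "\<dots> \<le> (1 / (\<alpha> * (\<rho> / 2) powr d)) * exp (- real m * (\<alpha> * \<rho> powr d))"
    using card_separated_le[OF T(3,1,2)] \<rho> \<alpha>_pos
    by (intro mult_right_mono) (auto simp: pos_le_divide_eq)
  finally have sum: "(\<Sum>x\<in>T. P.prob (miss x)) \<le> exp (- real m * (\<alpha> * \<rho> powr d)) / (\<alpha> * (\<rho> / 2) powr d)"
    by simp
  have "1 - P.prob ?C = P.prob (space ?P - ?C)" by (simp only: P.prob_compl[OF C])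
  also have "\<dots> \<le> P.prob (\<Union>x\<in>T. miss x)"
    using incl T miss by (intro P.finite_measure_mono) auto
  also have "\<dots> \<le> (\<Sum>x\<in>T. P.prob (miss x))"
    using T miss by (intro P.finite_measure_subadditive_finite) auto
  finally show ?thesis using sum by (simp add: prob_connected_def)
qed

text \<open>
  Cells are balls of radius \<open>4 * q\<close>, disjoint because their centres are \<open>8 * q\<close>-separated, with cores
  of radius \<open>2 * q\<close>. A sample in a core is at distance at least \<open>2 * q \<ge> 2 * r\<close> from everything
  outside its cell, so an isolated sample has a ball that meets no other. The first summand is
  the reciprocal of a lower bound for the expected number of isolated samples, in which
  \<open>1 / (\<beta> * (8 * q) powr d)\<close> bounds the number of cells from below.
\<close>

lemma prob_connected_le:
  assumes m: "2 \<le> m" and r: "0 < r" "r \<le> q" and q: "8 * q < \<delta>\<^sub>0"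
    and b: "\<beta> * (4 * q) powr d \<le> b" "b < 1"
  shows "prob_connected k \<mu> m r \<le>
    \<beta> * (8 * q) powr d / (real m * \<alpha> * (2 * q) powr d * (1 - b) ^ (m - 1)) + 1 / (1 - b)\<^sup>2 - 1"
proof -
  let ?I = "{1..m}" and ?P = "\<Pi>\<^sub>M i\<in>{1..m}. \<mu>"
  interpret P: prob_space ?P by (intro prob_space_PiM) (rule prob_space_axioms)
  have q0: "0 < q" using r by simp
  obtain T where T: "finite T" "T \<subseteq> F" "separated (8 * q) T" "F \<subseteq> (\<Union>x\<in>T. eball k x (8 * q))"
    using exists_separated_cover[of "8 * q"] q q0 by auto
  define core where "core x = eball k x (2 * q) \<inter> F" for x
  define big where "big x = eball k x (4 * q) \<inter> F" for x
  define S where "S = real m * (\<Sum>x\<in>T. prob (core x) * (1 - prob (big x)) ^ (m - 1))"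
  have big_le: "prob (big x) \<le> b" if "x \<in> T" for x
    using ball_upper[of x "4 * q"] that T q q0 b(1) unfolding big_def by (auto intro: order_trans)
  define W where "W = real m * \<alpha> * (2 * q) powr d * (1 - b) ^ (m - 1)"
  have W0: "0 < W" using m \<alpha>_pos q0 b by (simp add: W_def)
  have V0: "0 < \<beta> * (8 * q) powr d" using \<beta>_pos q0 by simp
  have "W / (\<beta> * (8 * q) powr d) \<le> real (card T) * W"
    using card_cover_ge[OF T(1,2,4)] q q0 V0 W0 by (simp add: pos_divide_le_eq mult_ac)
  also have "\<dots> = real m * (\<Sum>x\<in>T. \<alpha> * (2 * q) powr d * (1 - b) ^ (m - 1))"
    by (simp add: W_def)
  also have "\<dots> \<le> S"
    unfolding S_def using ball_lower[of _ "2 * q"] q q0 T big_le b \<alpha>_pos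
    by (intro mult_left_mono sum_mono mult_mono power_mono) (auto simp: core_def)
  finally have S: "W / (\<beta> * (8 * q) powr d) \<le> S" .
  have S0: "0 < S" using S W0 V0 by (smt (verit) divide_pos_pos)
  let ?C = "{X \<in> space ?P. connectedin (Euclidean_space k) (\<Union>i\<in>?I. eball k (X i) r)}"
  let ?N = "{X \<in> space ?P. \<not> (\<exists>i\<in>?I. \<exists>x\<in>T. X i \<in> core x \<and> (\<forall>l\<in>?I - {i}. X l \<notin> big x))}"
  have N: "?N \<in> P.events"
  proof -
    have [measurable]: "core x \<in> events" "big x \<in> events" for x
      by (simp_all add: core_def big_def sets_eball)
    show ?thesis using T(1) by measurable
  qed
  have incl: "?C \<subseteq> ?N"
  proof (rule subsetI, rule ccontr)
    fix X assume X: "X \<in> ?C" "X \<notin> ?N"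
    then obtain i x where ix: "i \<in> ?I" "x \<in> T" "X i \<in> core x" "\<forall>l\<in>?I - {i}. X l \<notin> big x"
      by auto
    have XF: "X l \<in> F" if "l \<in> ?I" for l using X(1) that by (auto simp: space_PiM PiE_iff)
    have "{i} \<noteq> ?I"
    proof
      assume "{i} = ?I"
      then have "card ?I = 1" by (metis is_singletonI is_singleton_altdef)
      then show False using m by simp
    qed
    then have single: "{i} \<in> Pow ?I - {{}, ?I}" using ix by auto
    have crossing: "\<forall>S\<in>Pow ?I - {{}, ?I}. \<exists>i\<in>S. \<exists>j\<in>?I - S. edist k (X i) (X j) < 2 * r"
      using X(1) XF F_subset union_eballs_connected_iff[OF r(1), of ?I X k] by auto
    from bspec[OF crossing single] have "\<exists>j\<in>?I - {i}. edist k (X i) (X j) < 2 * r" by simp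
    then obtain l where l: "l \<in> ?I - {i}" "edist k (X i) (X l) < 2 * r" by (elim bexE)
    have "edist k x (X l) < 4 * q"
      using ix(3) l(2) r edist_triangle[of k x "X l" "X i"] by (simp add: core_def mem_eball)
    then have "X l \<in> big x" using XF F_subset l by (auto simp: big_def mem_eball)
    then show False using ix l by blast
  qed
  have disj: "disjoint_family_on big T"
    using disjoint_half_balls[OF T(3)] by (simp add: big_def[abs_def])
  have "P.prob ?C \<le> P.prob ?N" by (rule P.finite_measure_mono[OF incl N])
  also have "\<dots> \<le> 1 / S + 1 / (1 - b)\<^sup>2 - 1"
  proof (rule prob_no_isolated_cell_le)
    show "disjoint_family_on big T" by (rule disj)
    show "core x \<subseteq> big x" for x using q0 by (auto simp: core_def big_def mem_eball)
  qed (use m T big_le b S0 in \<open>auto simp: S_def core_def big_def sets_eball\<close>)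
  also have "1 / S \<le> \<beta> * (8 * q) powr d / W"
    using S S0 W0 V0 by (simp add: field_simps)
  finally show ?thesis by (simp add: prob_connected_def W_def)
qed

end

section \<open>Asymptotics at the connectivity scale\<close>

lemma scaled_powr_inverse_powr:
  fixes d s a :: real
  assumes "0 < d" "0 < s" "0 \<le> a"
  shows "(s * a powr (1 / d)) powr d = s powr d * a"
  using assms by (simp add: powr_mult powr_powr)

lemma powr_minus_inverse_powr:
  fixes d x :: real
  assumes "0 < d" "0 < x"
  shows "(x powr (- 1 / d)) powr d = 1 / x"
proof -
  have "(x powr (- 1 / d)) powr d = x powr (- 1 / d * d)" by (rule powr_powr)
  also have "- 1 / d * d = - 1" using assms by simp
  finally show ?thesis using assms by (simp add: powr_minus_divide)
qed

lemma tendsto_connectivity_scale: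
  fixes d s :: real
  assumes "0 < d"
  shows "(\<lambda>m. s * (ln (real m) / real m) powr (1 / d)) \<longlonglongrightarrow> 0"
proof -
  have "(\<lambda>m. (ln (real m) / real m) powr (1 / d)) \<longlonglongrightarrow> 0"
  proof (rule tendsto_zero_powrI[of _ _ _ "1 / d"])
    show "(\<lambda>m. ln (real m) / real m) \<longlonglongrightarrow> 0" by real_asymp
    show "\<forall>\<^sub>F m in sequentially. 0 \<le> ln (real m) / real m" by real_asymp
  qed (use assms in auto)
  then show ?thesis by (rule tendsto_mult_right_zero)
qed

lemma one_minus_power_ge:
  fixes b :: real
  assumes "0 \<le> b" "b \<le> 1 / 2"
  shows "exp (- 2 * b * real n) \<le> (1 - b) ^ n"
proof -
  have "- b - 2 * b\<^sup>2 \<le> ln (1 - b)" by (rule ln_one_minus_pos_lower_bound[OF assms])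
  moreover have "2 * b\<^sup>2 \<le> b" using assms mult_left_mono[of b "1/2" b] by (simp add: power2_eq_square)
  ultimately have "- 2 * b \<le> ln (1 - b)" by linarith
  then have "exp (- 2 * b) \<le> 1 - b" using assms by (simp add: ln_ge_iff)
  then have "exp (- 2 * b) ^ n \<le> (1 - b) ^ n" by (intro power_mono) auto
  then show ?thesis by (simp add: exp_of_nat_mult[symmetric] mult_ac)
qed

context semi_uniform_measure
begin

text \<open>
  The constant is chosen so that \<open>\<alpha> * \<rho> powr d = ln m / m\<close>. A given ball is then missed with
  probability at most \<open>1 / m\<close>, against \<open>2 powr d * m / ln m\<close> balls: the failure probability
  is at most \<open>2 powr d / ln m\<close>.
\<close>

lemma eventually_prob_connected_ge:
  assumes d: "0 < d" and F: "connectedin (Euclidean_space k) F" and \<epsilon>: "0 < \<epsilon>"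
  shows "\<forall>\<^sub>F m in sequentially. \<forall>r > 2 * \<alpha> powr (- 1 / d) * (ln (real m) / real m) powr (1 / d).
    prob_connected k \<mu> m r \<ge> 1 - \<epsilon>"
proof -
  define \<rho> where "\<rho> m = \<alpha> powr (- 1 / d) * (ln (real m) / real m) powr (1 / d)" for m :: nat
  have "\<rho> \<longlonglongrightarrow> 0" unfolding \<rho>_def by (rule tendsto_connectivity_scale[OF d])
  then have "\<forall>\<^sub>F m in sequentially. \<rho> m < \<delta>\<^sub>0" using \<delta>\<^sub>0_pos order_tendstoD(2) by blast
  moreover have "(\<lambda>m. 2 powr d * (1 / ln (real m))) \<longlonglongrightarrow> 0"
    by (rule tendsto_mult_right_zero) real_asymp
  then have "\<forall>\<^sub>F m in sequentially. 2 powr d * (1 / ln (real m)) < \<epsilon>"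
    using \<epsilon> order_tendstoD(2) by blast
  ultimately show ?thesis
    using eventually_ge_at_top[of 2]
  proof eventually_elim
    case (elim m)
    define a where "a = ln (real m) / real m"
    have m: "0 < ln (real m)" "0 < real m" using elim by auto
    then have a0: "0 < a" by (simp add: a_def)
    have \<rho>_eq: "\<rho> m = \<alpha> powr (- 1 / d) * a powr (1 / d)" by (simp add: \<rho>_def a_def)
    have \<rho>0: "0 < \<rho> m" unfolding \<rho>_eq using \<alpha>_pos a0 by simp
    have hit: "\<alpha> * \<rho> m powr d = a"
      using scaled_powr_inverse_powr[OF d, of "\<alpha> powr (- 1 / d)" a]
        powr_minus_inverse_powr[OF d \<alpha>_pos] \<alpha>_pos a0 by (simp add: \<rho>_eq)
    have half: "\<alpha> * (\<rho> m / 2) powr d = a / 2 powr d"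
      using hit \<rho>0 by (simp add: powr_divide)
    have bound: "exp (- real m * (\<alpha> * \<rho> m powr d)) / (\<alpha> * (\<rho> m / 2) powr d) < \<epsilon>"
    proof -
      have "exp (- real m * (\<alpha> * \<rho> m powr d)) / (\<alpha> * (\<rho> m / 2) powr d) = 2 powr d * (1 / ln (real m))"
        unfolding hit half using m by (simp add: a_def exp_minus field_simps)
      then show ?thesis using elim(2) by simp
    qed
    show ?case
    proof (intro allI impI)
      fix r assume "2 * \<alpha> powr (- 1 / d) * (ln (real m) / real m) powr (1 / d) < r"
      then have "2 * \<rho> m \<le> r" by (simp add: \<rho>_def)
      from prob_connected_ge[OF F \<rho>0 elim(1) this, of m] bound
      show "prob_connected k \<mu> m r \<ge> 1 - \<epsilon>" by linarith
    qed
  qed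
qed

text \<open>
  The constant is chosen so that the bound \<open>\<beta> * (4 * q) powr d\<close> for the measure of a cell equals
  \<open>ln m / (4 * m)\<close>. The other samples then miss a cell with probability at least \<open>m powr (- 1 / 2)\<close>,
  and the expected number of isolated samples is at least a constant times \<open>m powr (1 / 2)\<close>.
\<close>

lemma eventually_prob_connected_le:
  assumes d: "0 < d" and \<epsilon>: "0 < \<epsilon>"
  shows "\<forall>\<^sub>F m in sequentially. \<forall>r. 0 < r \<and>
      r < (4 * \<beta>) powr (- 1 / d) / 4 * (ln (real m) / real m) powr (1 / d) \<longrightarrow>
    prob_connected k \<mu> m r \<le> \<epsilon>"
proof -
  define c where "c = (4 * \<beta>) powr (- 1 / d) / 4"
  have c0: "0 < c" using \<beta>_pos by (simp add: c_def)
  define q where "q m = c * (ln (real m) / real m) powr (1 / d)" for m :: nat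
  define K where "K = 4 powr d * \<beta> / \<alpha>"
  have K0: "0 < K" using \<alpha>_pos \<beta>_pos by (simp add: K_def)
  have "q \<longlonglongrightarrow> 0" unfolding q_def by (rule tendsto_connectivity_scale[OF d])
  then have "\<forall>\<^sub>F m in sequentially. q m < \<delta>\<^sub>0 / 8" using \<delta>\<^sub>0_pos by (intro order_tendstoD(2)) auto
  moreover have "\<forall>\<^sub>F m in sequentially. ln (real m) / real m / 4 < (1 / 2 :: real)" by real_asymp
  moreover have "(\<lambda>m. K * exp (- ln (real m) / 2) + 1 / (1 - ln (real m) / real m / 4)\<^sup>2 - 1) \<longlonglongrightarrow> K * 0 + 1 / (1 - 0)\<^sup>2 - 1"
    by (intro tendsto_intros; (simp; fail)?; real_asymp)
  then have "\<forall>\<^sub>F m in sequentially. K * exp (- ln (real m) / 2) + 1 / (1 - ln (real m) / real m / 4)\<^sup>2 - 1 < \<epsilon>"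
    using \<epsilon> by (intro order_tendstoD(2)) auto
  ultimately show ?thesis
    using eventually_ge_at_top[of 2]
  proof eventually_elim
    case (elim m)
    define a where "a = ln (real m) / real m"
    define b where "b = a / 4"
    have m: "0 < ln (real m)" "0 < real m" using elim by auto
    then have a0: "0 < a" by (simp add: a_def)
    have b: "0 \<le> b" "b \<le> 1 / 2" "b < 1" using a0 elim(2) by (auto simp: b_def a_def)
    have scale: "\<beta> * (t * q m) powr d = (t / 4) powr d * b" if "0 < t" for t
    proof -
      have "(t * q m) powr d = ((t / 4) * (4 * \<beta>) powr (- 1 / d) * a powr (1 / d)) powr d"
        by (simp add: q_def c_def a_def mult.assoc)
      also have "\<dots> = ((t / 4) * (4 * \<beta>) powr (- 1 / d)) powr d * a"
        using d \<beta>_pos a0 that by (intro scaled_powr_inverse_powr) auto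
      also have "\<dots> = (t / 4) powr d * (1 / (4 * \<beta>)) * a"
        using powr_minus_inverse_powr[OF d, of "4 * \<beta>"] \<beta>_pos that
        by (subst powr_mult) auto
      finally show ?thesis using \<beta>_pos by (simp add: b_def)
    qed
    have four: "\<beta> * (4 * q m) powr d = b" using scale[of 4] b by simp
    have eight: "\<beta> * (8 * q m) powr d = 2 powr d * b" using scale[of 8] by simp
    have "\<beta> * (2 * q m) powr d = b / 2 powr d" using scale[of 2] by (simp add: powr_divide)
    then have two: "(2 * q m) powr d = b / (\<beta> * 2 powr d)" using \<beta>_pos by (simp add: field_simps)
    have four_d: "(4 :: real) powr d = 2 powr d * 2 powr d" by (simp flip: powr_mult)
    have "exp (- ln (real m) / 2) = exp (- 2 * b * real m)"
      using m by (simp add: b_def a_def)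
    also have "\<dots> \<le> (1 - b) ^ m" by (rule one_minus_power_ge[OF b(1,2)])
    also have "\<dots> \<le> (1 - b) ^ (m - 1)" using b by (intro power_decreasing) auto
    finally have pow: "exp (- ln (real m) / 2) \<le> (1 - b) ^ (m - 1)" .
    have "\<beta> * (8 * q m) powr d / (real m * \<alpha> * (2 * q m) powr d * (1 - b) ^ (m - 1))
        = K / (real m * (1 - b) ^ (m - 1))"
      unfolding eight two K_def four_d using a0 \<beta>_pos \<alpha>_pos m b
      by (simp add: b_def field_simps)
    also have "\<dots> \<le> K / (real m * exp (- ln (real m) / 2))"
      using K0 m pow b by (intro divide_left_mono mult_left_mono mult_pos_pos) auto
    also have "real m * exp (- ln (real m) / 2) = exp (ln (real m) / 2)"
    proof -
      have "real m = exp (ln (real m))" using m by simp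
      then have "real m * exp (- ln (real m) / 2) = exp (ln (real m) + - ln (real m) / 2)"
        by (simp only: exp_add)
      then show ?thesis by simp
    qed
    also have "K / exp (ln (real m) / 2) = K * exp (- ln (real m) / 2)"
      by (simp add: exp_minus field_simps)
    finally have first: "\<beta> * (8 * q m) powr d / (real m * \<alpha> * (2 * q m) powr d * (1 - b) ^ (m - 1))
        \<le> K * exp (- ln (real m) / 2)" .
    show ?case
    proof (intro allI impI)
      fix r assume "0 < r \<and> r < (4 * \<beta>) powr (- 1 / d) / 4 * (ln (real m) / real m) powr (1 / d)"
      then have r: "0 < r" "r \<le> q m" by (auto simp: q_def c_def)
      have "8 * q m < \<delta>\<^sub>0" using elim(1) by simp
      from prob_connected_le[OF elim(4) r this eq_refl[OF four] b(3)] first elim(3)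
      show "prob_connected k \<mu> m r \<le> \<epsilon>" by (simp add: b_def a_def)
    qed
  qed
qed

end

theorem theorem1p2:
  fixes d \<alpha> \<beta> :: real
  assumes "0 < d" and "0 < \<alpha>" and "\<alpha> \<le> \<beta>"
  shows "\<exists>C c :: real. 0 < c \<and> c < C \<and>
    (\<forall>(k :: nat) (F :: (nat \<Rightarrow> real) set) (\<mu> :: (nat \<Rightarrow> real) measure) (\<delta>\<^sub>0 :: real).
       compactin (Euclidean_space k) F \<and> connectedin (Euclidean_space k) F \<and>
       semi_uniform k F \<mu> d \<delta>\<^sub>0 \<alpha> \<beta> \<longrightarrow>
       (\<forall>\<epsilon>>0. \<exists>m\<^sub>0 :: nat. \<forall>m\<ge>m\<^sub>0.
          (\<forall>r. r > C * (ln (real m) / real m) powr (1 / d) \<longrightarrow>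
             prob_connected k \<mu> m r \<ge> 1 - \<epsilon>) \<and>
          (\<forall>r. 0 < r \<and> r < c * (ln (real m) / real m) powr (1 / d) \<longrightarrow>
             prob_connected k \<mu> m r \<le> \<epsilon>)))"
proof -
  define C where "C = 2 * \<alpha> powr (- 1 / d)"
  define c where "c = (4 * \<beta>) powr (- 1 / d) / 4"
  have c_pos: "0 < c" using assms by (simp add: c_def)
  have c_less: "c < C"
  proof -
    have "(4 * \<beta>) powr (- 1 / d) \<le> \<alpha> powr (- 1 / d)"
      using assms by (intro powr_mono2') auto
    moreover have "0 < \<alpha> powr (- 1 / d)" using assms by simp
    ultimately show ?thesis unfolding c_def C_def by linarith
  qed
  have threshold: "\<exists>m\<^sub>0. \<forall>m\<ge>m\<^sub>0.
      (\<forall>r. r > C * (ln (real m) / real m) powr (1 / d) \<longrightarrow> prob_connected k \<mu> m r \<ge> 1 - \<epsilon>) \<and>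
      (\<forall>r. 0 < r \<and> r < c * (ln (real m) / real m) powr (1 / d) \<longrightarrow> prob_connected k \<mu> m r \<le> \<epsilon>)"
    if conn: "connectedin (Euclidean_space k) F" and semi: "semi_uniform k F \<mu> d \<delta>\<^sub>0 \<alpha> \<beta>" and "0 < \<epsilon>"
    for k F \<mu> \<delta>\<^sub>0 \<epsilon>
  proof -
    interpret semi_uniform_measure k F \<mu> d \<delta>\<^sub>0 \<alpha> \<beta>
      using semi connectedin_subset_topspace[OF conn] by unfold_locales
    show ?thesis
      using eventually_conj[OF eventually_prob_connected_ge[OF assms(1) conn \<open>0 < \<epsilon>\<close>]
          eventually_prob_connected_le[OF assms(1) \<open>0 < \<epsilon>\<close>]]
      unfolding eventually_sequentially C_def c_def .
  qed
  show ?thesis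
    by (intro exI[of _ C] exI[of _ c] conjI allI impI c_pos c_less) (elim conjE, rule threshold)
qed

end
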